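(* Let $\rho$ be a congruence on an inverse semigroup $S$ and let $K = \ker\rho$ be its kernel. Then, for all $s,t\in S$, $s \simeq_K t$ implies $s \mathrel{\rho} t$, and the induced mapping $\kappa : S/\!/K \to S/\rho$ carrying $[s]_K \mapsto \rho(s)$ is a surjective star-injective functor, where the inverse semigroup $S/\rho$ is regarded as a groupoid under trace products.
   Context: For an inverse semigroup $S$, $E(S)$ is its semilattice of idempotents and $\leq$ its natural partial order. A product $st$ is a trace product, written $s\cdot t$, when $s^{-1}s = tt^{-1}$; writing $a\cdot s\cdot b$ asserts $a^{-1}a = ss^{-1}$ and $s^{-1}s = bb^{-1}$. An inverse semigroup is regarded as an (ordered) groupoid with set of identities $E(S)$ and composition the trace product, $s$ having domain $ss^{-1}$ and range $s^{-1}s$. The kernel of a relation $\rho$ on $S$ is $\ker\rho=\{s\in S : s\mathrel{\rho} e\text{ for some }e\in E(S)\}$, and $\rho(s)$ denotes the $\rho$-class of $s$. An inverse subsemigroup $N$ of $S$ is normal if $E(N)=E(S)$ and $s^{-1}ns\in N$ for all $s\in S$, $n\in N$; the kernel of a congruence is normal. For normal $N$, define $s\leq_N t$ iff there exist $a,b\in N$ with $a\cdot s\cdot b\leq t$, and $s\simeq_N t$ iff $s\leq_N t$ and $t\leq_N s$ (an equivalence relation). $[s]_N$ is the $\simeq_N$-class of $s$ and $S/\!/N = S/{\simeq_N}$. $S/\!/N$ is a groupoid (indeed an ordered groupoid, ordered by $\leq_N$): the identities are the classes $[e]_N$, $e\in E(S)$; $[s]_N$ has domain $[ss^{-1}]_N$,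 range $[s^{-1}s]_N$, inverse $[s^{-1}]_N$; and if $s^{-1}s\simeq_N tt^{-1}$ the composition of $[s]_N$ and $[t]_N$ is $[sat]_N$ for any $a\in N$ with $aa^{-1}\leq s^{-1}s$ and $a^{-1}a=tt^{-1}$ (such $a$ exists, and the class is independent of choices). For a groupoid $G$ and identity $e$, $\mathrm{star}_G(e)=\{g\in G: gg^{-1}=e\}$; a functor $\theta:G\to H$ is star-injective if for each identity $e$ of $G$ its restriction $\mathrm{star}_G(e)\to\mathrm{star}_H(\theta(e))$ is injective. *)

theory Defs
  imports Main
begin

record 'a semigrp =
  carrier :: "'a set"
  mult :: "'a \<Rightarrow> 'a \<Rightarrow> 'a" (infixl \<open>\<odot>\<index>\<close> 70)

definition is_inverse :: "('a, 'm) semigrp_scheme \<Rightarrow> 'a \<Rightarrow> 'a \<Rightarrow> bool" where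
  "is_inverse S s t \<longleftrightarrow> s \<odot>\<^bsub>S\<^esub> t \<odot>\<^bsub>S\<^esub> s = s \<and> t \<odot>\<^bsub>S\<^esub> s \<odot>\<^bsub>S\<^esub> t = t"

locale inverse_semigroup =
  fixes S (structure)
  assumes closed: "\<lbrakk>s \<in> carrier S; t \<in> carrier S\<rbrakk> \<Longrightarrow> s \<odot> t \<in> carrier S"
    and assoc: "\<lbrakk>s \<in> carrier S; t \<in> carrier S; u \<in> carrier S\<rbrakk> \<Longrightarrow> s \<odot> t \<odot> u = s \<odot> (t \<odot> u)"
    and ex1_inverse: "s \<in> carrier S \<Longrightarrow> \<exists>!t. t \<in> carrier S \<and> is_inverse S s t"

definition sinv :: "('a, 'm) semigrp_scheme \<Rightarrow> 'a \<Rightarrow> 'a" where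
  "sinv S s = (THE t. t \<in> carrier S \<and> is_inverse S s t)"

definition idems :: "('a, 'm) semigrp_scheme \<Rightarrow> 'a set" where
  "idems S = {e \<in> carrier S. e \<odot>\<^bsub>S\<^esub> e = e}"

definition natural_le :: "('a, 'm) semigrp_scheme \<Rightarrow> 'a \<Rightarrow> 'a \<Rightarrow> bool" where
  "natural_le S s t \<longleftrightarrow> s \<in> carrier S \<and> t \<in> carrier S \<and> (\<exists>e\<in>idems S. s = e \<odot>\<^bsub>S\<^esub> t)"

definition sdom :: "('a, 'm) semigrp_scheme \<Rightarrow> 'a \<Rightarrow> 'a" where
  "sdom S s = s \<odot>\<^bsub>S\<^esub> sinv S s"

definition sran :: "('a, 'm) semigrp_scheme \<Rightarrow> 'a \<Rightarrow> 'a" where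
  "sran S s = sinv S s \<odot>\<^bsub>S\<^esub> s"

definition congruence :: "('a, 'm) semigrp_scheme \<Rightarrow> ('a \<times> 'a) set \<Rightarrow> bool" where
  "congruence S \<rho> \<longleftrightarrow> equiv (carrier S) \<rho> \<and>
     (\<forall>s t u v. (s, t) \<in> \<rho> \<longrightarrow> (u, v) \<in> \<rho> \<longrightarrow> (s \<odot>\<^bsub>S\<^esub> u, t \<odot>\<^bsub>S\<^esub> v) \<in> \<rho>)"

definition kernel :: "('a, 'm) semigrp_scheme \<Rightarrow> ('a \<times> 'a) set \<Rightarrow> 'a set" where
  "kernel S \<rho> = {s \<in> carrier S. \<exists>e\<in>idems S. (s, e) \<in> \<rho>}"

text \<open>
  Operations on quotients are the unions of the classes of all results obtained from
  representatives.  Distinct classes are disjoint, so such a nonempty union of classes is itself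
  a class exactly when the operation is independent of the representatives.
\<close>

definition quotient_semigroup :: "('a, 'm) semigrp_scheme \<Rightarrow> ('a \<times> 'a) set \<Rightarrow> 'a set semigrp" where
  "quotient_semigroup S \<rho> =
     \<lparr>carrier = carrier S // \<rho>, mult = (\<lambda>A B. \<Union>s\<in>A. \<Union>t\<in>B. \<rho> `` {s \<odot>\<^bsub>S\<^esub> t})\<rparr>"


text \<open>
  Groupoids are single-sorted: identities are arrows.  Composition is written from left to
  right, \<open>gcomp G x y\<close> being meaningful only if the range of \<open>x\<close> is the domain of \<open>y\<close>.
\<close>

record 'a groupoid_data =
  arrows :: "'a set"
  gdom :: "'a \<Rightarrow> 'a"
  gran :: "'a \<Rightarrow> 'a"
  ginv :: "'a \<Rightarrow> 'a"
  gcomp :: "'a \<Rightarrow> 'a \<Rightarrow> 'a"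

locale groupoid =
  fixes G :: "'a groupoid_data"
  assumes dom_closed: "x \<in> arrows G \<Longrightarrow> gdom G x \<in> arrows G"
    and ran_closed: "x \<in> arrows G \<Longrightarrow> gran G x \<in> arrows G"
    and dom_dom: "x \<in> arrows G \<Longrightarrow> gdom G (gdom G x) = gdom G x"
    and ran_dom: "x \<in> arrows G \<Longrightarrow> gran G (gdom G x) = gdom G x"
    and dom_ran: "x \<in> arrows G \<Longrightarrow> gdom G (gran G x) = gran G x"
    and ran_ran: "x \<in> arrows G \<Longrightarrow> gran G (gran G x) = gran G x"
    and comp_closed: "\<lbrakk>x \<in> arrows G; y \<in> arrows G; gran G x = gdom G y\<rbrakk>
      \<Longrightarrow> gcomp G x y \<in> arrows G"
    and dom_comp: "\<lbrakk>x \<in> arrows G; y \<in> arrows G; gran G x = gdom G y\<rbrakk>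
      \<Longrightarrow> gdom G (gcomp G x y) = gdom G x"
    and ran_comp: "\<lbrakk>x \<in> arrows G; y \<in> arrows G; gran G x = gdom G y\<rbrakk>
      \<Longrightarrow> gran G (gcomp G x y) = gran G y"
    and comp_assoc: "\<lbrakk>x \<in> arrows G; y \<in> arrows G; z \<in> arrows G;
        gran G x = gdom G y; gran G y = gdom G z\<rbrakk>
      \<Longrightarrow> gcomp G (gcomp G x y) z = gcomp G x (gcomp G y z)"
    and comp_dom_left: "x \<in> arrows G \<Longrightarrow> gcomp G (gdom G x) x = x"
    and comp_ran_right: "x \<in> arrows G \<Longrightarrow> gcomp G x (gran G x) = x"
    and inv_closed: "x \<in> arrows G \<Longrightarrow> ginv G x \<in> arrows G"
    and dom_inv: "x \<in> arrows G \<Longrightarrow> gdom G (ginv G x) = gran G x"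
    and ran_inv: "x \<in> arrows G \<Longrightarrow> gran G (ginv G x) = gdom G x"
    and comp_inv_right: "x \<in> arrows G \<Longrightarrow> gcomp G x (ginv G x) = gdom G x"
    and comp_inv_left: "x \<in> arrows G \<Longrightarrow> gcomp G (ginv G x) x = gran G x"

definition identities :: "'a groupoid_data \<Rightarrow> 'a set" where
  "identities G = gdom G ` arrows G"

definition star :: "'a groupoid_data \<Rightarrow> 'a \<Rightarrow> 'a set" where
  "star G e = {g \<in> arrows G. gcomp G g (ginv G g) = e}"

text \<open>
  Identities are the arrows of the form \<open>gdom G x\<close>, so preservation of \<open>gdom\<close> includes
  preservation of identities.
\<close>

locale groupoid_functor = G: groupoid G + H: groupoid H
  for G :: "'a groupoid_data" and H :: "'b groupoid_data" +
  fixes f :: "'a \<Rightarrow> 'b"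
  assumes map_arrows: "x \<in> arrows G \<Longrightarrow> f x \<in> arrows H"
    and map_dom: "x \<in> arrows G \<Longrightarrow> f (gdom G x) = gdom H (f x)"
    and map_ran: "x \<in> arrows G \<Longrightarrow> f (gran G x) = gran H (f x)"
    and map_comp: "\<lbrakk>x \<in> arrows G; y \<in> arrows G; gran G x = gdom G y\<rbrakk>
      \<Longrightarrow> f (gcomp G x y) = gcomp H (f x) (f y)"

definition star_injective :: "'a groupoid_data \<Rightarrow> ('a \<Rightarrow> 'b) \<Rightarrow> bool" where
  "star_injective G f \<longleftrightarrow> (\<forall>e\<in>identities G. inj_on f (star G e))"

definition trace_groupoid :: "('a, 'm) semigrp_scheme \<Rightarrow> 'a groupoid_data" where
  "trace_groupoid S =
     \<lparr>arrows = carrier S, gdom = sdom S, gran = sran S, ginv = sinv S, gcomp = mult S\<rparr>"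


definition le_mod :: "('a, 'm) semigrp_scheme \<Rightarrow> 'a set \<Rightarrow> 'a \<Rightarrow> 'a \<Rightarrow> bool" where
  "le_mod S N s t \<longleftrightarrow>
     (\<exists>a\<in>N. \<exists>b\<in>N. sran S a = sdom S s \<and> sran S s = sdom S b \<and>
        natural_le S (a \<odot>\<^bsub>S\<^esub> s \<odot>\<^bsub>S\<^esub> b) t)"

definition sim_mod :: "('a, 'm) semigrp_scheme \<Rightarrow> 'a set \<Rightarrow> ('a \<times> 'a) set" where
  "sim_mod S N =
     {(s, t). s \<in> carrier S \<and> t \<in> carrier S \<and> le_mod S N s t \<and> le_mod S N t s}"

definition class_mod :: "('a, 'm) semigrp_scheme \<Rightarrow> 'a set \<Rightarrow> 'a \<Rightarrow> 'a set" where
  "class_mod S N s = sim_mod S N `` {s}"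

definition quotient_groupoid :: "('a, 'm) semigrp_scheme \<Rightarrow> 'a set \<Rightarrow> 'a set groupoid_data" where
  "quotient_groupoid S N =
     \<lparr>arrows = carrier S // sim_mod S N,
      gdom = (\<lambda>A. \<Union>s\<in>A. class_mod S N (sdom S s)),
      gran = (\<lambda>A. \<Union>s\<in>A. class_mod S N (sran S s)),
      ginv = (\<lambda>A. \<Union>s\<in>A. class_mod S N (sinv S s)),
      gcomp = (\<lambda>A B. \<Union>s\<in>A. \<Union>t\<in>B.
         \<Union>a\<in>{a \<in> N. natural_le S (sdom S a) (sran S s) \<and> sran S a = sdom S t}.
           class_mod S N (s \<odot>\<^bsub>S\<^esub> a \<odot>\<^bsub>S\<^esub> t))\<rparr>"

end

(*
  The relation s <=_N t says exactly that s lies in the double coset NtN.  The kernel collapses to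
  idempotents under rho, so s <=_K t puts rho(s) below rho(t) in the natural order, and equivalent
  elements are congruent.  For star-injectivity, let s rho t and ss^{-1} = p tt^{-1} q with p, q in K.
  Then s = ss^{-1}s = p t (t^{-1} q s), and t^{-1} q s is congruent to t^{-1} q t, hence lies in K
  by normality; thus s lies in KtK.
*)

theory Submission
  imports Defs
begin

subsection \<open>Inverse semigroups\<close>

text \<open>A functor needs groupoids at both ends, and that is where most of the work lies.
  Composition in S//N depends on two representatives and on an element of N chosen between them. If
  aa^{-1} is below s^{-1}s and a^{-1}a = tt^{-1}, then a^{-1}s^{-1}sa = tt^{-1} can be inserted in
  front of t, so smt = (s(ma^{-1})s^{-1})(sat) for every m in N. By normality all these products lie
  in N(sat). This single fact yields independence of all choices and also associativity. On the
  other side, uniqueness of inverses is not visibly inherited by S/rho. Commuting idempotents are,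
  because Lallement's lemma lifts every idempotent class to an idempotent of S, and together with
  regularity they force uniqueness. The map kappa is realised as the image of a set under rho, so no
  representative has to be chosen.\<close>

context inverse_semigroup
begin

abbreviation inversion (\<open>\<iota>\<close>) where "\<iota> \<equiv> sinv S"
abbreviation natural_order (infix \<open>\<preceq>\<close> 50) where "s \<preceq> t \<equiv> natural_le S s t"

lemma
  assumes "s \<in> carrier S"
  shows sinv_closed: "\<iota> s \<in> carrier S"
    and mult_sinv_mult: "s \<odot> (\<iota> s \<odot> s) = s"
    and sinv_mult_sinv: "\<iota> s \<odot> (s \<odot> \<iota> s) = \<iota> s"
proof -
  have *: "\<iota> s \<in> carrier S \<and> is_inverse S s (\<iota> s)"
    unfolding sinv_def by (rule theI') (rule ex1_inverse[OF assms])
  then show "\<iota> s \<in> carrier S" by blast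
  with * assms show "s \<odot> (\<iota> s \<odot> s) = s" "\<iota> s \<odot> (s \<odot> \<iota> s) = \<iota> s"
    by (simp_all add: is_inverse_def assoc)
qed

lemma sinv_eqI:
  assumes "s \<in> carrier S" "t \<in> carrier S" "s \<odot> (t \<odot> s) = s" "t \<odot> (s \<odot> t) = t"
  shows "\<iota> s = t"
  unfolding sinv_def
  by (rule the1_equality[OF ex1_inverse]) (use assms in \<open>simp_all add: is_inverse_def assoc\<close>)

lemma sinv_sinv: "s \<in> carrier S \<Longrightarrow> \<iota> (\<iota> s) = s"
  by (intro sinv_eqI sinv_closed mult_sinv_mult sinv_mult_sinv)

text \<open>The trailing factor lets rewriting cancel in the middle of a right-nested product, the
  normal form produced by \<open>assoc\<close>.\<close>

lemma mult_sinv_mult_left: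
  "\<lbrakk>s \<in> carrier S; x \<in> carrier S\<rbrakk> \<Longrightarrow> s \<odot> (\<iota> s \<odot> (s \<odot> x)) = s \<odot> x"
  by (metis assoc closed mult_sinv_mult sinv_closed)

lemma sinv_mult_sinv_left:
  "\<lbrakk>s \<in> carrier S; x \<in> carrier S\<rbrakk> \<Longrightarrow> \<iota> s \<odot> (s \<odot> (\<iota> s \<odot> x)) = \<iota> s \<odot> x"
  by (metis assoc closed sinv_mult_sinv sinv_closed)

lemmas mult_simps = closed assoc sinv_closed sinv_sinv mult_sinv_mult sinv_mult_sinv
  mult_sinv_mult_left sinv_mult_sinv_left

lemma idems_closed: "e \<in> idems S \<Longrightarrow> e \<in> carrier S"
  and idems_idem: "e \<in> idems S \<Longrightarrow> e \<odot> e = e"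
  by (simp_all add: idems_def)

lemma sinv_idem: "e \<in> idems S \<Longrightarrow> \<iota> e = e"
  by (intro sinv_eqI) (simp_all add: idems_def)

lemma sdom_idems: "s \<in> carrier S \<Longrightarrow> sdom S s \<in> idems S"
  and sran_idems: "s \<in> carrier S \<Longrightarrow> sran S s \<in> idems S"
  by (simp_all add: idems_def sdom_def sran_def mult_simps)

lemma sdom_closed: "s \<in> carrier S \<Longrightarrow> sdom S s \<in> carrier S"
  and sran_closed: "s \<in> carrier S \<Longrightarrow> sran S s \<in> carrier S"
  by (simp_all add: sdom_def sran_def mult_simps)

lemma sdom_idem: "e \<in> idems S \<Longrightarrow> sdom S e = e"
  and sran_idem: "e \<in> idems S \<Longrightarrow> sran S e = e"
  by (simp_all add: sdom_def sran_def sinv_idem idems_idem)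

text \<open>If x is the inverse of ef, then fxe is also an inverse of ef, so x = fxe by uniqueness.
  Hence xx = f(xefx)e = x, and an idempotent is its own inverse, so ef = x.\<close>

lemma idems_mult:
  assumes e: "e \<in> idems S" and f: "f \<in> idems S"
  shows "e \<odot> f \<in> idems S"
proof -
  note [simp] = idems_closed[OF e] idems_closed[OF f] closed sinv_closed
  define x where "x = \<iota> (e \<odot> f)"
  have x [simp]: "x \<in> carrier S" by (simp add: x_def)
  have ee [simp]: "e \<odot> (e \<odot> y) = e \<odot> y" if "y \<in> carrier S" for y
    using that e by (simp flip: assoc add: idems_idem)
  have ff [simp]: "f \<odot> (f \<odot> y) = f \<odot> y" if "y \<in> carrier S" for y
    using that f by (simp flip: assoc add: idems_idem)
  have 1: "e \<odot> (f \<odot> (x \<odot> (e \<odot> f))) = e \<odot> f" and 2: "x \<odot> (e \<odot> (f \<odot> x)) = x"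
    using mult_sinv_mult[of "e \<odot> f"] sinv_mult_sinv[of "e \<odot> f"] by (simp_all add: x_def assoc)
  have 3: "x \<odot> (e \<odot> (f \<odot> (x \<odot> y))) = x \<odot> y" if "y \<in> carrier S" for y
    using arg_cong[OF 2, of "\<lambda>z. z \<odot> y"] that by (simp add: assoc)
  have "\<iota> (e \<odot> f) = f \<odot> (x \<odot> e)"
    by (rule sinv_eqI) (simp_all add: assoc 1 3)
  then have fxe: "x = f \<odot> (x \<odot> e)" by (simp only: x_def)
  then have "x \<odot> x = (f \<odot> (x \<odot> e)) \<odot> (f \<odot> (x \<odot> e))" by (rule arg_cong2) fact
  also have "\<dots> = f \<odot> (x \<odot> e)" by (simp add: assoc 3)
  also note fxe[symmetric]
  finally have "x \<in> idems S" by (simp add: idems_def)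
  moreover have "\<iota> x = e \<odot> f" by (simp add: x_def sinv_sinv)
  ultimately show ?thesis using sinv_idem by auto
qed

text \<open>Both ef and fe are idempotent, which makes them inverse to each other; but ef is also
  its own inverse.\<close>

lemma idems_commute:
  assumes e: "e \<in> idems S" and f: "f \<in> idems S"
  shows "e \<odot> f = f \<odot> e"
proof -
  note [simp] = idems_closed[OF e] idems_closed[OF f] closed
  have [simp]: "e \<odot> (e \<odot> y) = e \<odot> y" "f \<odot> (f \<odot> y) = f \<odot> y" if "y \<in> carrier S" for y
    using that e f by (simp_all flip: assoc add: idems_idem)
  have "\<iota> (e \<odot> f) = f \<odot> e"
    using idems_mult[OF e f] idems_mult[OF f e]
    by (intro sinv_eqI) (simp_all add: assoc idems_def)
  then show ?thesis
    using sinv_idem[OF idems_mult[OF e f]] by simp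
qed

lemma sinv_mult:
  assumes [simp]: "s \<in> carrier S" "t \<in> carrier S"
  shows "\<iota> (s \<odot> t) = \<iota> t \<odot> \<iota> s"
proof (rule sinv_eqI)
  \<comment> \<open>The idempotents s^{-1}s and tt^{-1} commute. This is stated with a trailing
    factor and used once in each direction, to bring each letter next to its inverse.\<close>
  have c: "\<iota> s \<odot> (s \<odot> (t \<odot> (\<iota> t \<odot> x))) = t \<odot> (\<iota> t \<odot> (\<iota> s \<odot> (s \<odot> x)))"
    if "x \<in> carrier S" for x
    using arg_cong[OF idems_commute[OF sran_idems sdom_idems, of s t], of "\<lambda>y. y \<odot> x"] that
    by (simp add: sran_def sdom_def mult_simps)
  show "s \<odot> t \<odot> (\<iota> t \<odot> \<iota> s \<odot> (s \<odot> t)) = s \<odot> t"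
    by (simp add: mult_simps flip: c)
  show "\<iota> t \<odot> \<iota> s \<odot> (s \<odot> t \<odot> (\<iota> t \<odot> \<iota> s)) = \<iota> t \<odot> \<iota> s"
    by (simp add: mult_simps c)
qed (simp_all add: mult_simps)

text \<open>The conjugate ses^{-1} is the domain of se.\<close>

lemma conj_idems:
  assumes "s \<in> carrier S" "e \<in> idems S"
  shows "s \<odot> e \<odot> \<iota> s \<in> idems S"
proof -
  have "s \<odot> e \<odot> \<iota> s = sdom S (s \<odot> e)"
    using assms by (simp add: sdom_def sinv_mult mult_simps idems_closed sinv_idem)
      (metis assoc closed idems_closed idems_idem sinv_closed)
  then show ?thesis using assms by (simp add: sdom_idems closed idems_closed)
qed

lemma sdom_mult_left: "s \<in> carrier S \<Longrightarrow> sdom S s \<odot> s = s"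
  and mult_sran_right: "s \<in> carrier S \<Longrightarrow> s \<odot> sran S s = s"
  and sdom_sinv: "s \<in> carrier S \<Longrightarrow> sdom S (\<iota> s) = sran S s"
  and sran_sinv: "s \<in> carrier S \<Longrightarrow> sran S (\<iota> s) = sdom S s"
  by (simp_all add: sdom_def sran_def mult_simps)

section \<open>Trace products and the natural partial order\<close>

lemma sdom_comp:
  assumes "s \<in> carrier S" "t \<in> carrier S" "sran S s = sdom S t"
  shows "sdom S (s \<odot> t) = sdom S s"
proof -
  have "sdom S (s \<odot> t) = s \<odot> sdom S t \<odot> \<iota> s"
    using assms(1,2) by (simp add: sdom_def sinv_mult mult_simps)
  then show ?thesis
    unfolding assms(3)[symmetric] using assms(1,2) by (simp add: mult_sran_right sdom_def[of S s])
qed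

lemma sran_comp:
  assumes "s \<in> carrier S" "t \<in> carrier S" "sran S s = sdom S t"
  shows "sran S (s \<odot> t) = sran S t"
proof -
  have "sran S (s \<odot> t) = \<iota> t \<odot> sran S s \<odot> t"
    using assms(1,2) by (simp add: sran_def sinv_mult mult_simps)
  also have "\<dots> = sran S t"
    unfolding assms(3) using assms(1,2) by (simp add: sdom_def sran_def mult_simps)
  finally show ?thesis .
qed

lemma groupoid_trace_groupoid: "groupoid (trace_groupoid S)"
  by unfold_locales
    (simp_all add: trace_groupoid_def sdom_closed sran_closed closed assoc sdom_idem sran_idem
      sdom_idems sran_idems sdom_comp sran_comp sdom_mult_left mult_sran_right sinv_closed
      sdom_sinv sran_sinv flip: sdom_def sran_def)

lemma natural_leI: "\<lbrakk>e \<in> idems S; t \<in> carrier S\<rbrakk> \<Longrightarrow> e \<odot> t \<preceq> t"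
  by (auto simp: natural_le_def closed idems_closed)

lemma natural_le_refl: "s \<in> carrier S \<Longrightarrow> s \<preceq> s"
  using natural_leI[OF sdom_idems] by (metis sdom_mult_left)

lemma natural_le_idem_absorb:
  assumes "s \<preceq> e" "e \<in> idems S"
  shows "s \<odot> e = s"
  using assms by (auto simp: natural_le_def assoc idems_closed idems_idem)

lemma natural_le_sdom:
  assumes "s \<preceq> t"
  shows "sdom S s \<preceq> sdom S t"
proof -
  obtain e where e: "e \<in> idems S" "s = e \<odot> t" and st: "s \<in> carrier S" "t \<in> carrier S"
    using assms by (auto simp: natural_le_def)
  have "sdom S s = e \<odot> (sdom S t \<odot> e)"
    using e st by (simp add: sdom_def sinv_mult mult_simps idems_closed sinv_idem)
  also have "\<dots> = e \<odot> (e \<odot> sdom S t)"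
    using e st by (simp add: idems_commute sdom_idems)
  also have "\<dots> = e \<odot> sdom S t"
    using e st by (simp flip: assoc add: idems_closed sdom_closed idems_idem)
  finally show ?thesis
    using e st by (simp add: natural_leI sdom_closed)
qed

end

text \<open>For two inverses t and u of s, swapping ts with us turns t = t(sus)t into ust, and
  swapping su with st turns ust into u. This route is taken for S/rho, where inverses exist by
  choosing representatives but their uniqueness does not come that way.\<close>

lemma inverse_semigroupI:
  fixes Q (structure)
  assumes closed: "\<And>s t. \<lbrakk>s \<in> carrier Q; t \<in> carrier Q\<rbrakk> \<Longrightarrow> s \<odot> t \<in> carrier Q"
    and assoc: "\<And>s t u. \<lbrakk>s \<in> carrier Q; t \<in> carrier Q; u \<in> carrier Q\<rbrakk>
      \<Longrightarrow> s \<odot> t \<odot> u = s \<odot> (t \<odot> u)"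
    and inverse: "\<And>s. s \<in> carrier Q \<Longrightarrow> \<exists>t\<in>carrier Q. is_inverse Q s t"
    and commute: "\<And>e f. \<lbrakk>e \<in> idems Q; f \<in> idems Q\<rbrakk> \<Longrightarrow> e \<odot> f = f \<odot> e"
  shows "inverse_semigroup Q"
proof
  fix s assume s: "s \<in> carrier Q"
  have uniq: "t = u"
    if t: "t \<in> carrier Q" "is_inverse Q s t" and u: "u \<in> carrier Q" "is_inverse Q s u" for t u
  proof -
    note [simp] = s t(1) u(1) closed
    have ids: "t \<odot> s \<in> idems Q" "u \<odot> s \<in> idems Q" "s \<odot> t \<in> idems Q" "s \<odot> u \<in> idems Q"
      using t u by (auto simp: idems_def is_inverse_def simp flip: assoc)
    have "t = t \<odot> (s \<odot> u \<odot> s) \<odot> t"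
      using t u by (simp add: is_inverse_def)
    also have "\<dots> = (t \<odot> s) \<odot> (u \<odot> s) \<odot> t"
      by (simp add: assoc)
    also have "\<dots> = (u \<odot> s) \<odot> (t \<odot> s) \<odot> t"
      by (simp only: commute[OF ids(1,2)])
    also have "\<dots> = u \<odot> s \<odot> t"
      using t by (simp add: is_inverse_def assoc)
    also have "\<dots> = u \<odot> ((s \<odot> u) \<odot> (s \<odot> t))"
      using u by (simp add: is_inverse_def flip: assoc)
    also have "\<dots> = u \<odot> ((s \<odot> t) \<odot> (s \<odot> u))"
      by (simp only: commute[OF ids(3,4)])
    also have "\<dots> = u"
      using t u by (simp add: is_inverse_def flip: assoc)
    finally show ?thesis .
  qed
  show "\<exists>!t. t \<in> carrier Q \<and> is_inverse Q s t"
    using inverse[OF s] uniq by blast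
qed (fact closed assoc)+

subsection \<open>The quotient groupoid of a normal inverse subsemigroup\<close>

text \<open>\<open>subset\<close> and \<open>idems_subset\<close> together encode E(N) =
  E(S).\<close>

locale normal_inverse_subsemigroup = inverse_semigroup +
  fixes N
  assumes subset: "n \<in> N \<Longrightarrow> n \<in> carrier S"
    and idems_subset: "e \<in> idems S \<Longrightarrow> e \<in> N"
    and mult_closed: "\<lbrakk>m \<in> N; n \<in> N\<rbrakk> \<Longrightarrow> m \<odot> n \<in> N"
    and inverse_closed: "n \<in> N \<Longrightarrow> sinv S n \<in> N"
    and conj_closed: "\<lbrakk>s \<in> carrier S; n \<in> N\<rbrakk> \<Longrightarrow> sinv S s \<odot> n \<odot> s \<in> N"
begin

lemma conj_closed': "\<lbrakk>s \<in> carrier S; n \<in> N\<rbrakk> \<Longrightarrow> s \<odot> n \<odot> \<iota> s \<in> N"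
  using conj_closed[of "\<iota> s" n] by (simp add: sinv_closed sinv_sinv)

text \<open>
  The trace conditions in the definition of \<open>\<le>\<^sub>N\<close> are immaterial: the relation only says that
  \<open>s\<close> lies in the double coset \<open>NtN\<close>, which makes it visibly transitive.
\<close>

lemma le_mod_iff:
  assumes s: "s \<in> carrier S" and t: "t \<in> carrier S"
  shows "le_mod S N s t \<longleftrightarrow> (\<exists>p\<in>N. \<exists>q\<in>N. s = p \<odot> t \<odot> q)"
proof
  assume "le_mod S N s t"
  then obtain a b e where N: "a \<in> N" "b \<in> N" and e: "e \<in> idems S"
    and tr: "sran S a = sdom S s" "sran S s = sdom S b" and le: "a \<odot> s \<odot> b = e \<odot> t"
    by (auto simp: le_mod_def natural_le_def)
  note c = subset[OF N(1)] subset[OF N(2)] s t idems_closed[OF e]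
  \<comment> \<open>The trace conditions allow a and b to be cancelled, s = a^{-1}(asb)b^{-1}; the
    idempotent of the natural order is then absorbed into the left factor.\<close>
  have "s = sran S a \<odot> s \<odot> sdom S b"
    using s by (simp flip: tr(2) add: tr(1) sdom_mult_left mult_sran_right)
  also have "\<dots> = \<iota> a \<odot> (a \<odot> s \<odot> b) \<odot> \<iota> b"
    using c by (simp add: sran_def sdom_def mult_simps)
  also have "\<dots> = (\<iota> a \<odot> e) \<odot> t \<odot> \<iota> b"
    unfolding le using c by (simp add: mult_simps)
  finally have "s = (\<iota> a \<odot> e) \<odot> t \<odot> \<iota> b" .
  moreover have "\<iota> a \<odot> e \<in> N" "\<iota> b \<in> N"
    using N e by (simp_all add: mult_closed inverse_closed idems_subset)
  ultimately show "\<exists>p\<in>N. \<exists>q\<in>N. s = p \<odot> t \<odot> q" by blast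
next
  assume "\<exists>p\<in>N. \<exists>q\<in>N. s = p \<odot> t \<odot> q"
  then obtain p q where N: "p \<in> N" "q \<in> N" and eq: "s = p \<odot> t \<odot> q"
    by blast
  note c [simp] = subset[OF N(1)] subset[OF N(2)] s t
  have ps: "p \<odot> (\<iota> p \<odot> s) = s" and sq: "s \<odot> (\<iota> q \<odot> q) = s"
    by (simp_all add: eq mult_simps)
  \<comment> \<open>Cutting p^{-1} down to the domain of s and q^{-1} down to its range creates the
    trace conditions: they hold because s = ptq is fixed by pp^{-1} on the left and by q^{-1}q on
    the right.\<close>
  define a b where "a = \<iota> p \<odot> sdom S s" and "b = sran S s \<odot> \<iota> q"
  have ab: "a \<in> N" "b \<in> N"
    using N by (simp_all add: a_def b_def mult_closed inverse_closed idems_subset sdom_idems sran_idems)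
  have "sran S a = sdom S s \<odot> (p \<odot> (\<iota> p \<odot> s)) \<odot> \<iota> s"
    by (simp add: a_def sran_def sdom_def sinv_mult mult_simps)
  then have 1: "sran S a = sdom S s"
    by (simp add: ps sdom_mult_left) (simp add: sdom_def)
  have "sdom S b = \<iota> s \<odot> (s \<odot> (\<iota> q \<odot> q)) \<odot> sran S s"
    by (simp add: b_def sran_def sdom_def sinv_mult mult_simps)
  then have 2: "sran S s = sdom S b"
    unfolding sq by (simp add: sran_def mult_simps)
  have "a \<odot> s \<odot> b = \<iota> p \<odot> s \<odot> \<iota> q"
    by (simp add: a_def b_def sran_def sdom_def mult_simps)
  also have "\<dots> = sran S p \<odot> (t \<odot> sdom S q)"
    by (simp add: eq sran_def sdom_def mult_simps)
  \<comment> \<open>\<open>natural_le\<close> multiplies by an idempotent on the left, so the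
    idempotent on the right of t is carried across: tf = (tft^{-1})t.\<close>
  also have "t \<odot> sdom S q = (t \<odot> sdom S q \<odot> \<iota> t) \<odot> t"
    using idems_commute[OF sdom_idems sran_idems, of q t]
    by (simp add: assoc closed sdom_closed sinv_closed sran_def)
      (simp add: mult_simps sdom_closed)
  also have "sran S p \<odot> \<dots> = (sran S p \<odot> (t \<odot> sdom S q \<odot> \<iota> t)) \<odot> t"
    by (simp add: mult_simps sdom_closed sran_closed)
  finally have "a \<odot> s \<odot> b \<preceq> t"
    by (simp add: natural_leI idems_mult conj_idems sran_idems sdom_idems)
  with ab 1 2 show "le_mod S N s t"
    unfolding le_mod_def by blast
qed

section \<open>The double-coset preorder and its equivalence classes\<close>

abbreviation quasi_le (infix \<open>\<lesssim>\<close> 50) where "s \<lesssim> t \<equiv> le_mod S N s t"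

lemma le_modI:
  "\<lbrakk>s = p \<odot> t \<odot> q; p \<in> N; q \<in> N; t \<in> carrier S\<rbrakk> \<Longrightarrow> s \<lesssim> t"
  using le_mod_iff[of s t] by (auto simp: closed subset)

lemma le_modI_left:
  assumes "s = p \<odot> t" "p \<in> N" "t \<in> carrier S"
  shows "s \<lesssim> t"
  by (rule le_modI[of _ p _ "sran S t"])
    (use assms in \<open>simp_all add: assoc subset mult_sran_right sran_closed idems_subset sran_idems\<close>)

lemma le_mod_refl: "s \<in> carrier S \<Longrightarrow> s \<lesssim> s"
  by (rule le_modI_left[of _ "sdom S s"]) (simp_all add: sdom_mult_left idems_subset sdom_idems)

lemma le_mod_trans:
  assumes "s \<lesssim> t" "t \<lesssim> u" and [simp]: "s \<in> carrier S" "t \<in> carrier S" "u \<in> carrier S"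
  shows "s \<lesssim> u"
proof -
  obtain p q where pq: "p \<in> N" "q \<in> N" "s = p \<odot> t \<odot> q"
    using assms by (auto simp: le_mod_iff)
  obtain p' q' where pq': "p' \<in> N" "q' \<in> N" "t = p' \<odot> u \<odot> q'"
    using assms by (auto simp: le_mod_iff)
  have "s = (p \<odot> p') \<odot> u \<odot> (q' \<odot> q)"
    using pq pq' by (simp add: subset mult_simps)
  then show ?thesis
    by (rule le_modI) (use pq pq' in \<open>simp_all add: mult_closed\<close>)
qed

lemma le_mod_sinv:
  assumes "s \<lesssim> t" and [simp]: "s \<in> carrier S" "t \<in> carrier S"
  shows "\<iota> s \<lesssim> \<iota> t"
proof -
  obtain p q where pq: "p \<in> N" "q \<in> N" "s = p \<odot> t \<odot> q"
    using assms by (auto simp: le_mod_iff)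
  then have "\<iota> s = \<iota> q \<odot> \<iota> t \<odot> \<iota> p"
    by (simp add: subset sinv_mult mult_simps)
  then show ?thesis
    by (rule le_modI) (use pq in \<open>simp_all add: inverse_closed sinv_closed\<close>)
qed

lemma le_mod_sdom:
  assumes "s \<lesssim> t" and [simp]: "s \<in> carrier S" "t \<in> carrier S"
  shows "sdom S s \<lesssim> sdom S t"
proof -
  obtain p q where pq: "p \<in> N" "q \<in> N" and eq: "s = p \<odot> t \<odot> q"
    using assms by (auto simp: le_mod_iff)
  \<comment> \<open>Here ss^{-1} = p t(qq^{-1})t^{-1} p^{-1}. The conjugate of qq^{-1} by t is an
    idempotent and so may count as part of the right-hand factor from N.\<close>
  have "sdom S s = p \<odot> sdom S t \<odot> ((t \<odot> sdom S q \<odot> \<iota> t) \<odot> \<iota> p)"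
    using pq by (simp add: eq sdom_def subset sinv_mult mult_simps)
  then show ?thesis
    by (rule le_modI)
      (use pq in \<open>simp_all add: mult_closed inverse_closed idems_subset conj_idems sdom_idems
        sdom_closed subset\<close>)
qed

lemma le_mod_sran:
  assumes "s \<lesssim> t" "s \<in> carrier S" "t \<in> carrier S"
  shows "sran S s \<lesssim> sran S t"
  using le_mod_sdom[OF le_mod_sinv[OF assms]] assms by (simp add: sinv_closed sdom_sinv)

lemma sim_mod_iff:
  "(s, t) \<in> sim_mod S N \<longleftrightarrow> s \<in> carrier S \<and> t \<in> carrier S \<and> s \<lesssim> t \<and> t \<lesssim> s"
  by (simp add: sim_mod_def)

lemma equiv_sim_mod: "equiv (carrier S) (sim_mod S N)"
proof (rule equivI)
  show "sim_mod S N \<subseteq> carrier S \<times> carrier S" by (auto simp: sim_mod_iff)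
  show "refl_on (carrier S) (sim_mod S N)"
    by (auto simp: refl_on_def sim_mod_iff le_mod_refl)
  show "sym (sim_mod S N)" by (auto simp: sym_def sim_mod_iff)
  show "trans (sim_mod S N)"
    by (rule transI) (auto simp: sim_mod_iff intro: le_mod_trans)
qed

lemma class_mod_eq_iff:
  "\<lbrakk>s \<in> carrier S; t \<in> carrier S\<rbrakk>
    \<Longrightarrow> class_mod S N s = class_mod S N t \<longleftrightarrow> s \<lesssim> t \<and> t \<lesssim> s"
  unfolding class_mod_def using eq_equiv_class_iff[OF equiv_sim_mod] by (simp add: sim_mod_iff)

lemma class_mod_self: "s \<in> carrier S \<Longrightarrow> s \<in> class_mod S N s"
  by (simp add: class_mod_def sim_mod_iff le_mod_refl)

lemma in_class_mod_iff: "t \<in> class_mod S N s \<longleftrightarrow> (s, t) \<in> sim_mod S N"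
  by (simp add: class_mod_def)

text \<open>This turns the union encoding of operations on classes into evaluation at a
  representative.\<close>

lemma UN_class_mod:
  assumes "s \<in> carrier S" and "\<And>t. (s, t) \<in> sim_mod S N \<Longrightarrow> f t = f s"
  shows "(\<Union>t\<in>class_mod S N s. f t) = f s"
  using class_mod_self[OF assms(1)]
  by (intro SUP_eq_const assms(2)) (blast, simp only: in_class_mod_iff)

section \<open>Composition of classes through connecting elements of N\<close>

definition connector :: "'a \<Rightarrow> 'a \<Rightarrow> 'a \<Rightarrow> bool" where
  "connector s t a \<longleftrightarrow> a \<in> N \<and> sdom S a \<preceq> sran S s \<and> sran S a = sdom S t"

abbreviation (input) cls where "cls \<equiv> class_mod S N"
abbreviation (input) Q where "Q \<equiv> quotient_groupoid S N"

lemma gdom_class: "s \<in> carrier S \<Longrightarrow> gdom Q (cls s) = cls (sdom S s)"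
  and gran_class: "s \<in> carrier S \<Longrightarrow> gran Q (cls s) = cls (sran S s)"
  and ginv_class: "s \<in> carrier S \<Longrightarrow> ginv Q (cls s) = cls (\<iota> s)"
  unfolding quotient_groupoid_def groupoid_data.select_convs
  by (rule UN_class_mod;
      simp add: class_mod_eq_iff sim_mod_iff le_mod_sdom le_mod_sran le_mod_sinv
        sdom_closed sran_closed sinv_closed)+

lemma arrows_quotient: "arrows Q = cls ` carrier S"
  by (auto simp: quotient_groupoid_def quotient_def class_mod_def)

text \<open>A witness pair a, b for the domain of t lying below the range of s already contains the
  connector. The trace product ab has domain aa^{-1}, and taking domains preserves the natural
  order.\<close>

lemma connector_exists:
  assumes "cls (sran S s) = cls (sdom S t)" and [simp]: "s \<in> carrier S" "t \<in> carrier S"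
  obtains a where "connector s t a"
proof -
  note [simp] = sran_closed sdom_closed
  have "sdom S t \<lesssim> sran S s"
    using assms(1) by (simp add: class_mod_eq_iff)
  then obtain a b where N: "a \<in> N" "b \<in> N"
    and tr: "sran S a = sdom S t" "sdom S t = sdom S b"
    and le: "a \<odot> sdom S t \<odot> b \<preceq> sran S s"
    by (auto simp: le_mod_def sran_idem sdom_idem sdom_idems)
  have [simp]: "a \<in> carrier S" "b \<in> carrier S" using N by (simp_all add: subset)
  have "a \<odot> sdom S t \<odot> b = a \<odot> b"
    using mult_sran_right[of a] by (simp add: tr(1))
  then have "sdom S a \<preceq> sran S s"
    using natural_le_sdom[OF le] tr by (simp add: sdom_comp sdom_idem sran_idems)
  with N tr show thesis by (intro that) (auto simp: connector_def)
qed

text \<open>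
  Normality moves a factor from \<open>N\<close> across \<open>s\<close>; thus all products \<open>smt\<close> with \<open>m\<close> in \<open>N\<close> lie
  below \<open>sat\<close>, which is therefore determined up to equivalence.
\<close>

lemma connector_absorb:
  assumes a: "connector s t a" and m: "m \<in> N"
    and [simp]: "s \<in> carrier S" "t \<in> carrier S"
  obtains n where "n \<in> N" "s \<odot> m \<odot> t = n \<odot> (s \<odot> a \<odot> t)"
proof -
  have N: "a \<in> N" and dom: "sdom S a \<preceq> sran S s" and ran: "sran S a = sdom S t"
    using a by (auto simp: connector_def)
  have [simp]: "a \<in> carrier S" "m \<in> carrier S" using N m by (simp_all add: subset)
  \<comment> \<open>Since aa^{-1} lies below s^{-1}s, the element a absorbs s^{-1}s; therefore sa
    has range a^{-1}a = tt^{-1}.\<close>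
  have "a = sran S s \<odot> a"
  proof -
    have "sran S s \<odot> sdom S a = sdom S a"
      using natural_le_idem_absorb[OF dom] by (simp add: sran_idems sdom_idems idems_commute)
    then show ?thesis
      by (metis \<open>a \<in> carrier S\<close> assms(3) assoc sdom_closed sdom_mult_left sran_closed)
  qed
  then have sa: "\<iota> a \<odot> \<iota> s \<odot> s \<odot> a = sran S a"
    by (simp add: sran_def mult_simps)
  \<comment> \<open>The range of sa is inserted in front of t, which exposes n =
    s(ma^{-1})s^{-1}.\<close>
  have "s \<odot> m \<odot> t = s \<odot> m \<odot> (sran S a \<odot> t)"
    by (simp add: ran sdom_mult_left)
  also have "\<dots> = s \<odot> (m \<odot> \<iota> a) \<odot> \<iota> s \<odot> (s \<odot> a \<odot> t)"
    by (simp flip: sa add: mult_simps)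
  finally show thesis
    using m N by (intro that) (simp_all add: conj_closed' mult_closed inverse_closed)
qed

text \<open>With s = ps'q and t = ut'v, the product sat equals p(s'(qau)t')v. As qau is in N,
  \<open>connector_absorb\<close> replaces it by b at the cost of one more left factor from
  N.\<close>

lemma connector_le:
  assumes a: "connector s t a" and b: "connector s' t' b"
    and le: "s \<lesssim> s'" "t \<lesssim> t'"
    and [simp]: "s \<in> carrier S" "t \<in> carrier S" "s' \<in> carrier S" "t' \<in> carrier S"
  shows "s \<odot> a \<odot> t \<lesssim> s' \<odot> b \<odot> t'"
proof -
  have a_N: "a \<in> N" and b_N: "b \<in> N" using a b by (auto simp: connector_def)
  obtain p q where pq: "p \<in> N" "q \<in> N" "s = p \<odot> s' \<odot> q"
    using le by (auto simp: le_mod_iff)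
  obtain u v where uv: "u \<in> N" "v \<in> N" "t = u \<odot> t' \<odot> v"
    using le by (auto simp: le_mod_iff)
  note [simp] = subset[OF pq(1)] subset[OF pq(2)] subset[OF uv(1)] subset[OF uv(2)]
    subset[OF a_N] subset[OF b_N]
  have "q \<odot> a \<odot> u \<in> N" using pq uv a_N by (simp add: mult_closed)
  then obtain n where n: "n \<in> N" "s' \<odot> (q \<odot> a \<odot> u) \<odot> t' = n \<odot> (s' \<odot> b \<odot> t')"
    using connector_absorb[OF b] by (metis assms(7,8))
  have "s \<odot> a \<odot> t = p \<odot> (s' \<odot> (q \<odot> a \<odot> u) \<odot> t') \<odot> v"
    by (simp add: pq(3) uv(3) mult_simps)
  also have "\<dots> = (p \<odot> n) \<odot> (s' \<odot> b \<odot> t') \<odot> v"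
    unfolding n(2) using n(1) by (simp add: mult_simps subset)
  finally show ?thesis
    by (rule le_modI) (use pq uv n in \<open>simp_all add: mult_closed closed\<close>)
qed

text \<open>By \<open>connector_le\<close> in both directions, all representatives and connectors
  contribute the same class to the union; a itself shows that the union is not empty.\<close>

lemma gcomp_class:
  assumes a: "connector s t a" and [simp]: "s \<in> carrier S" "t \<in> carrier S"
  shows "gcomp Q (cls s) (cls t) = cls (s \<odot> a \<odot> t)"
proof -
  have a_N: "a \<in> N" using a by (simp add: connector_def)
  have eq: "cls (s' \<odot> b \<odot> t') = cls (s \<odot> a \<odot> t)"
    if "s' \<in> cls s" "t' \<in> cls t" "connector s' t' b" for s' t' b
  proof -
    have b_N: "b \<in> N" using that by (simp add: connector_def)
    have "s' \<odot> b \<odot> t' \<lesssim> s \<odot> a \<odot> t" "s \<odot> a \<odot> t \<lesssim> s' \<odot> b \<odot> t'"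
      using that a by (auto simp: in_class_mod_iff sim_mod_iff intro!: connector_le)
    then show ?thesis
      using that a_N b_N
      by (intro class_mod_eq_iff[THEN iffD2] conjI)
        (auto simp: in_class_mod_iff sim_mod_iff closed subset)
  qed
  let ?U = "\<Union>s'\<in>cls s. \<Union>t'\<in>cls t. \<Union>b\<in>{b. connector s' t' b}. cls (s' \<odot> b \<odot> t')"
  have "?U \<subseteq> cls (s \<odot> a \<odot> t)" by (auto simp: eq)
  moreover have "cls (s \<odot> a \<odot> t) \<subseteq> ?U"
    using a class_mod_self[of s] class_mod_self[of t] by auto
  ultimately show ?thesis by (simp add: quotient_groupoid_def connector_def)
qed

lemma connector_sran:
  assumes "connector s t a" and [simp]: "s \<in> carrier S" "t \<in> carrier S"
  shows "sran S (s \<odot> a \<odot> t) = sran S t"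
proof -
  have a_N: "a \<in> N" and dom: "sdom S a \<preceq> sran S s" and ran: "sran S a = sdom S t"
    using assms by (auto simp: connector_def)
  have [simp]: "a \<in> carrier S" using a_N by (simp add: subset)
  have "sran S s \<odot> sdom S a = sdom S a"
    using natural_le_idem_absorb[OF dom] by (simp add: sran_idems sdom_idems idems_commute)
  then have "sran S s \<odot> a = a"
    by (metis \<open>a \<in> carrier S\<close> assms(2) assoc sdom_closed sdom_mult_left sran_closed)
  then have *: "\<iota> s \<odot> (s \<odot> (a \<odot> t)) = a \<odot> t"
    by (simp add: sran_def mult_simps flip: assoc)
  have "sran S (s \<odot> a \<odot> t) = \<iota> t \<odot> \<iota> a \<odot> (\<iota> s \<odot> (s \<odot> (a \<odot> t)))"
    by (simp add: sran_def sinv_mult mult_simps)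
  also have "\<dots> = \<iota> t \<odot> sran S a \<odot> t"
    unfolding * by (simp add: sran_def mult_simps)
  finally show ?thesis by (simp add: ran) (simp add: sran_def sdom_def mult_simps)
qed

text \<open>Ranges of sat and t agree exactly, but passing through a may shrink the domain of s, so
  domains agree only up to equivalence. The bound on the domain of s comes from conjugating s^{-1}s
  = p tt^{-1} q by s.\<close>

lemma connector_sdom:
  assumes a: "connector s t a" and [simp]: "s \<in> carrier S" "t \<in> carrier S"
    and sim: "cls (sran S s) = cls (sdom S t)"
  shows "cls (sdom S (s \<odot> a \<odot> t)) = cls (sdom S s)"
proof -
  have a_N: "a \<in> N" and dom: "sdom S a \<preceq> sran S s" and ran: "sran S a = sdom S t"
    using a by (auto simp: connector_def)
  have [simp]: "a \<in> carrier S" using a_N by (simp add: subset)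
  note [simp] = sdom_closed sran_closed closed sinv_closed
  have "sdom S (s \<odot> a \<odot> t) = sdom S s \<odot> sdom S (s \<odot> a \<odot> t)"
    by (simp add: sdom_def sinv_mult mult_simps)
  also have "\<dots> = sdom S (s \<odot> a \<odot> t) \<odot> sdom S s"
    by (simp add: idems_commute sdom_idems)
  finally have 1: "sdom S (s \<odot> a \<odot> t) \<lesssim> sdom S s"
    by (rule le_modI_left) (simp_all add: idems_subset sdom_idems)
  have "sran S s \<lesssim> sdom S t" using sim by (simp add: class_mod_eq_iff)
  then obtain p q where pq: "p \<in> N" "q \<in> N" "sran S s = p \<odot> sdom S t \<odot> q"
    by (auto simp: le_mod_iff)
  have [simp]: "p \<in> carrier S" "q \<in> carrier S" using pq by (simp_all add: subset)
  have fs: "sdom S a \<odot> sran S s = sdom S a"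
    using natural_le_idem_absorb[OF dom] by (simp add: sran_idems)
  then have sf: "sran S s \<odot> sdom S a = sdom S a"
    by (simp add: sran_idems sdom_idems idems_commute)
  have dsat: "sdom S (s \<odot> a \<odot> t) = s \<odot> sdom S a \<odot> \<iota> s"
  proof -
    have "sdom S (s \<odot> a \<odot> t) = s \<odot> (a \<odot> sdom S t \<odot> \<iota> a) \<odot> \<iota> s"
      by (simp add: sdom_def sinv_mult mult_simps)
    then show ?thesis by (simp flip: ran add: mult_sran_right) (simp add: sdom_def)
  qed
  have "sdom S s = s \<odot> sran S s \<odot> \<iota> s" by (simp add: sdom_def mult_sran_right)
  \<comment> \<open>Here tt^{-1} = a^{-1}a is expanded to a^{-1}(aa^{-1})a, so that the domain of a
    appears between two elements of N.\<close>
  also have "sran S s = (p \<odot> \<iota> a) \<odot> sdom S a \<odot> (a \<odot> q)"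
    unfolding pq(3) by (simp flip: ran) (simp add: sdom_def sran_def mult_simps)
  \<comment> \<open>Placing s^{-1}s on both sides of aa^{-1} splits the conjugate by s into three
    conjugates: the outer two lie in N by normality, the middle one is the domain of sat.\<close>
  also have "sdom S a = sran S s \<odot> sdom S a \<odot> sran S s"
    by (simp add: fs sf)
  finally have "sdom S s =
      (s \<odot> (p \<odot> \<iota> a) \<odot> \<iota> s) \<odot> sdom S (s \<odot> a \<odot> t) \<odot> (s \<odot> (a \<odot> q) \<odot> \<iota> s)"
    unfolding dsat by (simp add: sran_def assoc)
  then have 2: "sdom S s \<lesssim> sdom S (s \<odot> a \<odot> t)"
    by (rule le_modI) (simp_all add: conj_closed' mult_closed inverse_closed a_N pq)
  from 1 2 show ?thesis by (simp add: class_mod_eq_iff)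
qed

text \<open>Each bracketing is absorbed into the other: tcu lies in N(tbu) and s(an)(tbu) in
  N(sd(tbu)); conversely sdt lies in N(sat) and (sat)bu in N((sat)cu).\<close>

lemma connector_assoc:
  assumes a: "connector s t a" and b: "connector t u b"
    and c: "connector (s \<odot> a \<odot> t) u c" and d: "connector s (t \<odot> b \<odot> u) d"
    and [simp]: "s \<in> carrier S" "t \<in> carrier S" "u \<in> carrier S"
  shows "cls (s \<odot> a \<odot> t \<odot> c \<odot> u) = cls (s \<odot> d \<odot> (t \<odot> b \<odot> u))"
proof -
  have N: "a \<in> N" "b \<in> N" "c \<in> N" "d \<in> N"
    using a b c d by (simp_all add: connector_def)
  then have [simp]: "a \<in> carrier S" "b \<in> carrier S" "c \<in> carrier S" "d \<in> carrier S"
    by (simp_all add: subset)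
  note [simp] = closed
  obtain n where n: "n \<in> N" "t \<odot> c \<odot> u = n \<odot> (t \<odot> b \<odot> u)"
    using connector_absorb[OF b N(3)] by auto
  obtain m where m: "m \<in> N" "s \<odot> (a \<odot> n) \<odot> (t \<odot> b \<odot> u) = m \<odot> (s \<odot> d \<odot> (t \<odot> b \<odot> u))"
    using connector_absorb[OF d mult_closed[OF N(1) n(1)]] by auto
  have "s \<odot> a \<odot> t \<odot> c \<odot> u = s \<odot> a \<odot> (t \<odot> c \<odot> u)" by (simp add: assoc)
  also have "\<dots> = s \<odot> (a \<odot> n) \<odot> (t \<odot> b \<odot> u)"
    unfolding n(2) using n(1) by (simp add: assoc subset)
  also note m(2)
  finally have 1: "s \<odot> a \<odot> t \<odot> c \<odot> u \<lesssim> s \<odot> d \<odot> (t \<odot> b \<odot> u)"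
    by (rule le_modI_left) (simp_all add: m)
  obtain n' where n': "n' \<in> N" "s \<odot> d \<odot> t = n' \<odot> (s \<odot> a \<odot> t)"
    using connector_absorb[OF a N(4)] by auto
  obtain m' where m': "m' \<in> N" "s \<odot> a \<odot> t \<odot> b \<odot> u = m' \<odot> (s \<odot> a \<odot> t \<odot> c \<odot> u)"
    using connector_absorb[OF c N(2)] by auto
  have "s \<odot> d \<odot> (t \<odot> b \<odot> u) = (s \<odot> d \<odot> t) \<odot> b \<odot> u" by (simp add: assoc)
  also have "\<dots> = n' \<odot> (s \<odot> a \<odot> t \<odot> b \<odot> u)"
    unfolding n'(2) using n'(1) by (simp add: assoc subset)
  also have "\<dots> = (n' \<odot> m') \<odot> (s \<odot> a \<odot> t \<odot> c \<odot> u)"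
    unfolding m'(2) using n'(1) m'(1) by (simp add: assoc subset)
  finally have 2: "s \<odot> d \<odot> (t \<odot> b \<odot> u) \<lesssim> s \<odot> a \<odot> t \<odot> c \<odot> u"
    by (rule le_modI_left) (simp_all add: mult_closed n' m')
  from 1 2 show ?thesis by (simp add: class_mod_eq_iff)
qed

lemma connector_sdom_self: "s \<in> carrier S \<Longrightarrow> connector (sdom S s) s (sdom S s)"
  and connector_sran_self: "s \<in> carrier S \<Longrightarrow> connector s (sran S s) (sran S s)"
  and connector_sinv_right: "s \<in> carrier S \<Longrightarrow> connector s (\<iota> s) (sran S s)"
  and connector_sinv_left: "s \<in> carrier S \<Longrightarrow> connector (\<iota> s) s (sdom S s)"
  by (simp_all add: connector_def idems_subset sdom_idems sran_idems sdom_idem sran_idem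
      natural_le_refl sdom_closed sran_closed sdom_sinv sran_sinv)

lemma groupoid_quotient_groupoid: "groupoid Q"
proof -
  note cl = sdom_closed sran_closed sinv_closed
  note maps = gdom_class gran_class ginv_class
  have "gcomp Q x y \<in> arrows Q \<and> gdom Q (gcomp Q x y) = gdom Q x \<and> gran Q (gcomp Q x y) = gran Q y"
    if xy: "x \<in> arrows Q" "y \<in> arrows Q" "gran Q x = gdom Q y" for x y
  proof -
    obtain s t where st: "s \<in> carrier S" "x = cls s" "t \<in> carrier S" "y = cls t"
      using xy by (auto simp: arrows_quotient)
    have sim: "cls (sran S s) = cls (sdom S t)" using xy st by (simp add: maps)
    then obtain a where a: "connector s t a" using connector_exists st by blast
    then have "a \<in> carrier S" by (simp add: connector_def subset)
    with a st sim show ?thesis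
      by (auto simp: arrows_quotient gcomp_class maps closed connector_sran connector_sdom)
  qed
  note comp = this
  have assoc': "gcomp Q (gcomp Q x y) z = gcomp Q x (gcomp Q y z)"
    if xyz: "x \<in> arrows Q" "y \<in> arrows Q" "z \<in> arrows Q" "gran Q x = gdom Q y"
      "gran Q y = gdom Q z" for x y z
  proof -
    obtain s t u where st: "s \<in> carrier S" "x = cls s" "t \<in> carrier S" "y = cls t"
      "u \<in> carrier S" "z = cls u"
      using xyz by (auto simp: arrows_quotient)
    have sim: "cls (sran S s) = cls (sdom S t)" "cls (sran S t) = cls (sdom S u)"
      using xyz st by (simp_all add: maps)
    obtain a where a: "connector s t a" using connector_exists sim st by blast
    obtain b where b: "connector t u b" using connector_exists sim st by blast
    have c: "s \<odot> a \<odot> t \<in> carrier S" "t \<odot> b \<odot> u \<in> carrier S"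
      using a b st by (simp_all add: connector_def subset closed)
    obtain c' where c': "connector (s \<odot> a \<odot> t) u c'"
      using connector_exists[of "s \<odot> a \<odot> t" u] sim st c a by (auto simp: connector_sran)
    obtain d where d: "connector s (t \<odot> b \<odot> u) d"
      using connector_exists[of s "t \<odot> b \<odot> u"] sim st c b by (auto simp: connector_sdom)
    show ?thesis
      using connector_assoc[OF a b c' d] st c a b c' d by (simp add: gcomp_class)
  qed
  have "gcomp Q (cls (sdom S s)) (cls s) = cls s" "gcomp Q (cls s) (cls (sran S s)) = cls s"
    "gcomp Q (cls s) (cls (\<iota> s)) = cls (sdom S s)" "gcomp Q (cls (\<iota> s)) (cls s) = cls (sran S s)"
    if "s \<in> carrier S" for s
    using that gcomp_class[OF connector_sdom_self[of s]] gcomp_class[OF connector_sran_self[of s]]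
      gcomp_class[OF connector_sinv_right[of s]] gcomp_class[OF connector_sinv_left[of s]]
    by (simp_all add: cl assoc sdom_mult_left mult_sran_right sdom_idems sran_idems idems_idem)
      (simp_all add: sdom_def sran_def mult_simps)
  then show ?thesis
    by unfold_locales
      (auto simp: comp assoc', auto simp: arrows_quotient maps cl sdom_idem sran_idem sdom_idems
        sran_idems sdom_sinv sran_sinv)
qed

end

subsection \<open>Congruences and their kernels\<close>

locale inverse_semigroup_congruence = inverse_semigroup +
  fixes \<rho>
  assumes congruence: "congruence S \<rho>"
begin

lemma equiv: "equiv (carrier S) \<rho>"
  and cong_mult: "\<lbrakk>(s, t) \<in> \<rho>; (u, v) \<in> \<rho>\<rbrakk> \<Longrightarrow> (s \<odot> u, t \<odot> v) \<in> \<rho>"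
  using congruence by (auto simp: congruence_def)

lemma cong_closed: "(s, t) \<in> \<rho> \<Longrightarrow> s \<in> carrier S \<and> t \<in> carrier S"
  using equiv by (auto simp: equiv_def)

lemma cong_refl: "s \<in> carrier S \<Longrightarrow> (s, s) \<in> \<rho>"
  using equiv by (auto simp: equiv_def refl_on_def)

lemma cong_sym: "(s, t) \<in> \<rho> \<Longrightarrow> (t, s) \<in> \<rho>"
  using equiv by (auto simp: equiv_def sym_def)

lemma cong_trans [trans]: "\<lbrakk>(s, t) \<in> \<rho>; (t, u) \<in> \<rho>\<rbrakk> \<Longrightarrow> (s, u) \<in> \<rho>"
  using equiv by (auto simp: equiv_def trans_def)

lemma class_eq_iff:
  "\<lbrakk>s \<in> carrier S; t \<in> carrier S\<rbrakk> \<Longrightarrow> \<rho> `` {s} = \<rho> `` {t} \<longleftrightarrow> (s, t) \<in> \<rho>"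
  using eq_equiv_class_iff[OF equiv] .

lemma carrier_quotient: "carrier (quotient_semigroup S \<rho>) = (\<lambda>s. \<rho> `` {s}) ` carrier S"
  by (auto simp: quotient_semigroup_def quotient_def)

lemma mult_quotient:
  assumes "s \<in> carrier S" "t \<in> carrier S"
  shows "\<rho> `` {s} \<odot>\<^bsub>quotient_semigroup S \<rho>\<^esub> \<rho> `` {t} = \<rho> `` {s \<odot> t}"
proof -
  have "\<rho> `` {s' \<odot> t'} = \<rho> `` {s \<odot> t}" if "(s, s') \<in> \<rho>" "(t, t') \<in> \<rho>" for s' t'
    using that assms cong_closed by (intro class_eq_iff[THEN iffD2])
      (auto intro: closed cong_mult cong_sym)
  moreover have "s \<in> \<rho> `` {s}" "t \<in> \<rho> `` {t}"
    using assms by (simp_all add: cong_refl)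
  ultimately have "(\<Union>s'\<in>\<rho> `` {s}. \<Union>t'\<in>\<rho> `` {t}. \<rho> `` {s' \<odot> t'}) = \<rho> `` {s \<odot> t}"
    by (intro SUP_eq_const) blast+
  then show ?thesis by (simp add: quotient_semigroup_def)
qed

text \<open>With x the inverse of ss, the element e = sxs is idempotent because x(ss)x = x. Since ss
  is congruent to s, so are ss = (ss)x(ss) and sxs.\<close>

lemma lallement:
  assumes "X \<in> idems (quotient_semigroup S \<rho>)"
  obtains e where "e \<in> idems S" "X = \<rho> `` {e}"
proof -
  obtain s where s [simp]: "s \<in> carrier S" and X: "X = \<rho> `` {s}"
    using assms by (auto simp: idems_def carrier_quotient)
  note [simp] = closed sinv_closed assoc
  have "\<rho> `` {s \<odot> s} = \<rho> `` {s}" using assms X by (simp add: idems_def mult_quotient)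
  then have ss: "(s \<odot> s, s) \<in> \<rho>" by (simp add: class_eq_iff)
  define x where "x = \<iota> (s \<odot> s)"
  have x [simp]: "x \<in> carrier S" by (simp add: x_def)
  have "x \<odot> ((s \<odot> s) \<odot> x) = x"
    unfolding x_def by (rule sinv_mult_sinv) simp
  then have "x \<odot> (s \<odot> (s \<odot> (x \<odot> s))) = x \<odot> s"
    by (simp flip: assoc)
  then have "s \<odot> x \<odot> s \<in> idems S" by (simp add: idems_def)
  moreover have "(s \<odot> s \<odot> x \<odot> (s \<odot> s), s \<odot> x \<odot> s) \<in> \<rho>"
    by (intro cong_mult ss cong_refl) simp
  then have "(s \<odot> s, s \<odot> x \<odot> s) \<in> \<rho>"
    using mult_sinv_mult[of "s \<odot> s"] by (simp add: x_def)
  then have "X = \<rho> `` {s \<odot> x \<odot> s}"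
    unfolding X using ss by (subst class_eq_iff) (auto intro: cong_trans cong_sym)
  ultimately show thesis by (rule that)
qed

lemma inverse_semigroup_quotient: "inverse_semigroup (quotient_semigroup S \<rho>)"
proof (rule inverse_semigroupI)
  fix X assume "X \<in> carrier (quotient_semigroup S \<rho>)"
  then obtain s where s: "s \<in> carrier S" "X = \<rho> `` {s}" by (auto simp: carrier_quotient)
  then show "\<exists>Y\<in>carrier (quotient_semigroup S \<rho>). is_inverse (quotient_semigroup S \<rho>) X Y"
    by (intro bexI[of _ "\<rho> `` {\<iota> s}"])
      (simp_all add: carrier_quotient is_inverse_def mult_quotient mult_simps)
next
  fix X Y assume "X \<in> idems (quotient_semigroup S \<rho>)" "Y \<in> idems (quotient_semigroup S \<rho>)"
  then obtain e f where "e \<in> idems S" "X = \<rho> `` {e}" "f \<in> idems S" "Y = \<rho> `` {f}"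
    by (metis lallement)
  then show "X \<odot>\<^bsub>quotient_semigroup S \<rho>\<^esub> Y = Y \<odot>\<^bsub>quotient_semigroup S \<rho>\<^esub> X"
    by (simp add: mult_quotient idems_closed idems_commute)
qed (auto simp: carrier_quotient mult_quotient closed assoc)

sublocale quot: inverse_semigroup "quotient_semigroup S \<rho>"
  by (rule inverse_semigroup_quotient)

lemma sinv_quotient:
  "s \<in> carrier S \<Longrightarrow> sinv (quotient_semigroup S \<rho>) (\<rho> `` {s}) = \<rho> `` {\<iota> s}"
  by (rule quot.sinv_eqI) (simp_all add: carrier_quotient mult_quotient mult_simps)

lemma cong_sinv:
  assumes "(s, t) \<in> \<rho>"
  shows "(\<iota> s, \<iota> t) \<in> \<rho>"
  using assms cong_closed[OF assms] sinv_quotient[of s] sinv_quotient[of t]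
  by (metis class_eq_iff sinv_closed)

lemma sdom_quotient:
    "s \<in> carrier S \<Longrightarrow> sdom (quotient_semigroup S \<rho>) (\<rho> `` {s}) = \<rho> `` {sdom S s}"
  and sran_quotient:
    "s \<in> carrier S \<Longrightarrow> sran (quotient_semigroup S \<rho>) (\<rho> `` {s}) = \<rho> `` {sran S s}"
  by (simp_all add: sdom_def sran_def sinv_quotient mult_quotient sinv_closed)

section \<open>The kernel and the induced map from S//K to S/rho\<close>

abbreviation K where "K \<equiv> kernel S \<rho>"

lemma kernelE:
  assumes "a \<in> K"
  obtains e where "a \<in> carrier S" "e \<in> idems S" "(a, e) \<in> \<rho>"
  using assms by (auto simp: kernel_def)

lemma kernelI: "\<lbrakk>(a, e) \<in> \<rho>; e \<in> idems S\<rbrakk> \<Longrightarrow> a \<in> K"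
  using cong_closed by (auto simp: kernel_def)

text \<open>If a is congruent to an idempotent e, then a^{-1}a is congruent to ee = e. The
  unspecified idempotent is thus replaced by the one that trace conditions mention.\<close>

lemma kernel_cong_sran:
  assumes "a \<in> K"
  shows "(a, sran S a) \<in> \<rho>"
proof -
  obtain e where e: "e \<in> idems S" "(a, e) \<in> \<rho>" using assms by (rule kernelE)
  have "(sran S a, e) \<in> \<rho>"
    using cong_mult[OF cong_sinv[OF e(2)] e(2)] e by (simp add: sran_def sinv_idem idems_idem)
  then show ?thesis using e by (metis cong_sym cong_trans)
qed

sublocale ker: normal_inverse_subsemigroup S K
proof
  show "n \<in> carrier S" if "n \<in> K" for n using that by (simp add: kernel_def)
  show "e \<in> K" if "e \<in> idems S" for e using kernelI[OF cong_refl[OF idems_closed]] that by blast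
  show "m \<odot> n \<in> K" if "m \<in> K" "n \<in> K" for m n
    using that by (elim kernelE) (blast intro: kernelI cong_mult idems_mult)
  show "\<iota> n \<in> K" if "n \<in> K" for n
    using that by (elim kernelE) (metis kernelI cong_sinv sinv_idem)
  show "\<iota> s \<odot> n \<odot> s \<in> K" if s: "s \<in> carrier S" and n: "n \<in> K" for s n
  proof -
    obtain e where e: "e \<in> idems S" "(n, e) \<in> \<rho>" using n by (rule kernelE)
    have "(\<iota> s \<odot> n \<odot> s, \<iota> s \<odot> e \<odot> s) \<in> \<rho>"
      using s e by (intro cong_mult cong_refl sinv_closed)
    moreover have "\<iota> s \<odot> e \<odot> s \<in> idems S"
      using conj_idems[of "\<iota> s" e] s e by (simp add: sinv_closed sinv_sinv)
    ultimately show ?thesis by (rule kernelI)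
  qed
qed

text \<open>The conclusion is the natural order between rho-classes, written with the domain of s as
  idempotent. Modulo rho, a and b become the domain and range of s, so s is congruent to asb =
  et.\<close>

lemma kernel_le_imp_class_le:
  assumes "le_mod S K s t" and [simp]: "s \<in> carrier S" "t \<in> carrier S"
  shows "(sdom S s \<odot> t, s) \<in> \<rho>"
proof -
  obtain a b where K: "a \<in> K" "b \<in> K" and tr: "sran S a = sdom S s" "sran S s = sdom S b"
    and le: "a \<odot> s \<odot> b \<preceq> t"
    using assms by (auto simp: le_mod_def)
  have [simp]: "a \<in> carrier S" "b \<in> carrier S" using K by (simp_all add: ker.subset)
  obtain e where e: "e \<in> idems S" "a \<odot> s \<odot> b = e \<odot> t"
    using le by (auto simp: natural_le_def)
  have "(b, sdom S b) \<in> \<rho>"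
    using kernel_cong_sran[OF ker.inverse_closed[OF K(2)]]
    by (metis \<open>b \<in> carrier S\<close> cong_sinv sdom_idems sinv_idem sinv_sinv sran_sinv)
  then have "(a \<odot> s \<odot> b, sdom S s \<odot> s \<odot> sran S s) \<in> \<rho>"
    using kernel_cong_sran[OF K(1)] by (intro cong_mult) (simp_all add: tr cong_refl)
  then have es: "(e \<odot> t, s) \<in> \<rho>"
    by (simp add: sdom_mult_left mult_sran_right e)
  note [simp] = idems_closed[OF e(1)] closed sdom_closed
  \<comment> \<open>The idempotent e is arbitrary, but an element below t is its own domain times t,
    and domains respect rho; this lets the domain of s take the place of e.\<close>
  have et: "sdom S (e \<odot> t) \<odot> t = e \<odot> t"
  proof -
    have "sdom S (e \<odot> t) \<odot> t = e \<odot> (sdom S t \<odot> e) \<odot> t"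
      using e by (simp add: sdom_def sinv_mult mult_simps sinv_idem)
    also have "\<dots> = e \<odot> e \<odot> (sdom S t \<odot> t)"
      using e by (simp add: idems_commute[OF sdom_idems] assoc)
    finally show ?thesis using e by (simp add: sdom_mult_left idems_idem)
  qed
  have "(sdom S (e \<odot> t), sdom S s) \<in> \<rho>"
    unfolding sdom_def by (intro cong_mult cong_sinv es)
  then have "(sdom S (e \<odot> t) \<odot> t, sdom S s \<odot> t) \<in> \<rho>"
    by (intro cong_mult cong_refl) simp_all
  with es show ?thesis unfolding et by (metis cong_sym cong_trans)
qed

text \<open>This is antisymmetry of the natural order in S/rho, carried out on representatives:
  (tt^{-1})s is congruent to t and, since idempotents commute, also to s.\<close>

lemma sim_kernel_imp_cong:
  assumes "(s, t) \<in> sim_mod S K"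
  shows "(s, t) \<in> \<rho>"
proof -
  have [simp]: "s \<in> carrier S" "t \<in> carrier S"
    using assms by (simp_all add: ker.sim_mod_iff)
  have st: "(sdom S s \<odot> t, s) \<in> \<rho>" and ts: "(sdom S t \<odot> s, t) \<in> \<rho>"
    using assms by (auto simp: ker.sim_mod_iff intro: kernel_le_imp_class_le)
  note [simp] = sdom_closed closed
  have "(sdom S t \<odot> s, s) \<in> \<rho>"
  proof -
    have "(sdom S t \<odot> (sdom S s \<odot> t), sdom S t \<odot> s) \<in> \<rho>"
      by (intro cong_mult st cong_refl) simp
    moreover have "sdom S t \<odot> (sdom S s \<odot> t) = sdom S s \<odot> t"
      by (metis \<open>s \<in> carrier S\<close> \<open>t \<in> carrier S\<close> assoc idems_commute sdom_closed sdom_idems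
          sdom_mult_left)
    ultimately show ?thesis using st by (metis cong_sym cong_trans)
  qed
  with ts show ?thesis by (metis cong_sym cong_trans)
qed

text \<open>A class modulo K lies inside one rho-class, so taking its image under rho is the induced
  map without any choice of representative.\<close>

lemma Image_class_kernel:
  assumes "s \<in> carrier S"
  shows "\<rho> `` class_mod S K s = \<rho> `` {s}"
  using ker.class_mod_self[OF assms] sim_kernel_imp_cong
  by (auto simp: ker.in_class_mod_iff) (blast intro: cong_trans)

lemma groupoid_functor_kernel:
  "groupoid_functor (quotient_groupoid S K) (trace_groupoid (quotient_semigroup S \<rho>))
    (\<lambda>A. \<rho> `` A)"
  (is "groupoid_functor ?G ?H _")
proof (intro groupoid_functor.intro groupoid_functor_axioms.intro
    ker.groupoid_quotient_groupoid quot.groupoid_trace_groupoid)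
  fix x assume "x \<in> arrows ?G"
  then obtain s where "s \<in> carrier S" "x = class_mod S K s"
    by (auto simp: ker.arrows_quotient)
  then show "\<rho> `` x \<in> arrows ?H" "\<rho> `` gdom ?G x = gdom ?H (\<rho> `` x)"
    "\<rho> `` gran ?G x = gran ?H (\<rho> `` x)"
    by (simp_all add: trace_groupoid_def carrier_quotient Image_class_kernel ker.gdom_class
        ker.gran_class sdom_closed sran_closed sdom_quotient sran_quotient)
next
  fix x y assume "x \<in> arrows ?G" "y \<in> arrows ?G" and r: "gran ?G x = gdom ?G y"
  then obtain s t where st [simp]: "s \<in> carrier S" "t \<in> carrier S"
    and xy: "x = class_mod S K s" "y = class_mod S K t"
    by (auto simp: ker.arrows_quotient)
  obtain a where a: "ker.connector s t a"
    using r ker.connector_exists[of s t] by (auto simp: xy ker.gran_class ker.gdom_class)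
  then have aK: "a \<in> K" and ran: "sran S a = sdom S t" by (simp_all add: ker.connector_def)
  have [simp]: "a \<in> carrier S" using aK by (rule ker.subset)
  \<comment> \<open>The connector is congruent to its range tt^{-1}, which t absorbs, so the
    inserted factor disappears in S/rho.\<close>
  have "(s \<odot> a \<odot> t, s \<odot> sdom S t \<odot> t) \<in> \<rho>"
    using kernel_cong_sran[OF aK] by (intro cong_mult cong_refl) (simp_all add: ran)
  then have "\<rho> `` {s \<odot> a \<odot> t} = \<rho> `` {s \<odot> t}"
    by (simp add: class_eq_iff closed assoc sdom_closed sdom_mult_left)
  then show "\<rho> `` gcomp ?G x y = gcomp ?H (\<rho> `` x) (\<rho> `` y)"
    by (simp add: xy ker.gcomp_class[OF a] Image_class_kernel closed trace_groupoid_def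
        mult_quotient)
qed

lemma kernel_le_if_cong:
  assumes "(s, t) \<in> \<rho>" and le: "le_mod S K (sdom S s) (sdom S t)"
  shows "le_mod S K s t"
proof -
  have [simp]: "s \<in> carrier S" "t \<in> carrier S" using cong_closed[OF assms(1)] by simp_all
  note [simp] = closed sinv_closed sdom_closed
  obtain p q where pq: "p \<in> K" "q \<in> K" "sdom S s = p \<odot> sdom S t \<odot> q"
    using le by (auto simp: ker.le_mod_iff)
  have [simp]: "p \<in> carrier S" "q \<in> carrier S" using pq by (simp_all add: ker.subset)
  have "s = sdom S s \<odot> s" by (simp add: sdom_mult_left)
  also have "\<dots> = p \<odot> t \<odot> (\<iota> t \<odot> q \<odot> s)"
    unfolding pq(3) by (simp add: sdom_def assoc)
  finally have s_eq: "s = p \<odot> t \<odot> (\<iota> t \<odot> q \<odot> s)" .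
  have "(\<iota> t \<odot> q \<odot> s, \<iota> t \<odot> q \<odot> t) \<in> \<rho>"
    using assms by (intro cong_mult cong_refl) simp_all
  moreover have "\<iota> t \<odot> q \<odot> t \<in> K" using pq by (simp add: ker.conj_closed)
  \<comment> \<open>The kernel is a union of rho-classes, so membership passes along the
    congruence.\<close>
  ultimately have "\<iota> t \<odot> q \<odot> s \<in> K"
    by (elim kernelE) (metis cong_trans kernelI)
  with s_eq pq show ?thesis by (elim ker.le_modI) simp_all
qed

lemma star_injective_kernel: "star_injective (quotient_groupoid S K) (\<lambda>A. \<rho> `` A)"
  unfolding star_injective_def
proof (intro ballI inj_onI)
  interpret Q: groupoid "quotient_groupoid S K" by (rule ker.groupoid_quotient_groupoid)
  fix e x y
  assume xy: "x \<in> star (quotient_groupoid S K) e" "y \<in> star (quotient_groupoid S K) e"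
    and eq: "\<rho> `` x = \<rho> `` y"
  \<comment> \<open>Stars are defined through gg^{-1}, which in a groupoid is the domain; a common
    star therefore provides the equivalence of ss^{-1} and tt^{-1} that
    \<open>kernel_le_if_cong\<close> uses in both directions.\<close>
  have d: "gdom (quotient_groupoid S K) x = gdom (quotient_groupoid S K) y"
    using xy by (auto simp: star_def Q.comp_inv_right)
  obtain s t where st [simp]: "s \<in> carrier S" "t \<in> carrier S"
    and cl: "x = class_mod S K s" "y = class_mod S K t"
    using xy by (auto simp: star_def ker.arrows_quotient)
  have "le_mod S K (sdom S s) (sdom S t)" "le_mod S K (sdom S t) (sdom S s)"
    using d by (simp_all add: cl ker.gdom_class ker.class_mod_eq_iff sdom_closed)
  moreover have "(s, t) \<in> \<rho>"
    using eq by (simp add: cl Image_class_kernel class_eq_iff)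
  ultimately show "x = y"
    by (simp add: cl ker.class_mod_eq_iff kernel_le_if_cong cong_sym)
qed

end

theorem proposition3p2:
  fixes S :: "('a, 'm) semigrp_scheme"
    and \<rho> :: "('a \<times> 'a) set"
    and K :: "'a set"
  assumes "inverse_semigroup S"
    and "congruence S \<rho>"
    and "K = kernel S \<rho>"
  shows "(\<forall>s\<in>carrier S. \<forall>t\<in>carrier S. (s, t) \<in> sim_mod S K \<longrightarrow> (s, t) \<in> \<rho>) \<and>
    (\<exists>\<kappa>. (\<forall>s\<in>carrier S. \<kappa> (class_mod S K s) = \<rho> `` {s}) \<and>
      groupoid_functor (quotient_groupoid S K) (trace_groupoid (quotient_semigroup S \<rho>)) \<kappa> \<and>
      \<kappa> ` arrows (quotient_groupoid S K) = arrows (trace_groupoid (quotient_semigroup S \<rho>)) \<and>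
      star_injective (quotient_groupoid S K) \<kappa>)"
proof -
  interpret inverse_semigroup S by fact
  interpret inverse_semigroup_congruence S \<rho> by unfold_locales fact
  have "(\<lambda>A. \<rho> `` A) ` arrows (quotient_groupoid S (kernel S \<rho>)) =
      arrows (trace_groupoid (quotient_semigroup S \<rho>))"
    by (simp add: ker.arrows_quotient image_image Image_class_kernel trace_groupoid_def
        carrier_quotient)
  then show ?thesis
    unfolding assms(3)
    using sim_kernel_imp_cong Image_class_kernel groupoid_functor_kernel star_injective_kernel
    by (intro conjI exI[of _ "\<lambda>A. \<rho> `` A"]) auto
qed

end
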